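(* Let $T\subseteq\mathbb{R}^N$ be a nonempty finite set and let $\mathcal{W}(T)=\mathbb{E}\max_{t\in T}\langle Z,t\rangle$ with $Z\sim N(0,I_N)$. For every probability measure (prior) $\pi$ on $T$, $$\mathcal{W}(T)=\frac12\int_0^\infty \mathrm{MSE}_s\bigl(\widehat X_s^{\mathrm{MLE}}\bigr)\,ds,$$ where $\mathrm{MSE}_s(\widehat X_s^{\mathrm{MLE}})$ is the mean-squared error of the maximum likelihood estimator at signal-to-noise ratio $s$ in the Gaussian additive model with prior $\pi$.
   Context: Gaussian additive model: for $s\ge 0$, let $X\sim\pi$ and $Z\sim N(0,I_N)$ be independent, and observe $Y_s=sX+Z\in\mathbb{R}^N$. For an estimator $\hat A:\mathbb{R}^N\to\mathbb{R}^N$, define $\mathrm{MSE}_s(\hat A)=\mathbb{E}\|X-\hat A(Y_s)\|_2^2$. Maximum likelihood estimator: for each $s\ge 0$, $\widehat X_s^{\mathrm{MLE}}$ is the $T$-valued function of $Y_s$ satisfying $$\widehat X_s^{\mathrm{MLE}}\in\arg\max_{u\in T}\Bigl\{\langle Y_s,u\rangle-\frac{s}{2}\|u\|_2^2\Bigr\},$$ where ties are broken arbitrarily. Here $\langle\cdot,\cdot\rangle$ and $\|\cdot\|_2$ are the Euclidean inner product and norm on $\mathbb{R}^N$. *)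

theory Defs
  imports "HOL-Probability.Probability"
begin

definition std_gaussian :: "(real ^ 'n) measure" where
  "std_gaussian = density lborel (\<lambda>z. ennreal (\<Prod>i\<in>UNIV. std_normal_density (z $ i)))"

definition gaussian_width :: "(real ^ 'n) set \<Rightarrow> real" where
  "gaussian_width T = (LINT z | std_gaussian. Max ((\<lambda>t. z \<bullet> t) ` T))"

text \<open>A prior on \<open>T\<close> is represented as a Borel probability measure on the ambient space
  that gives mass one to \<open>T\<close>.\<close>

definition prior_on :: "(real ^ 'n) set \<Rightarrow> (real ^ 'n) measure \<Rightarrow> bool" where
  "prior_on T \<pi> \<longleftrightarrow> prob_space \<pi> \<and> sets \<pi> = sets borel \<and> emeasure \<pi> T = 1"

definition gaussian_model ::
  "'w measure \<Rightarrow> (real ^ 'n) measure \<Rightarrow> ('w \<Rightarrow> real ^ 'n) \<Rightarrow> ('w \<Rightarrow> real ^ 'n) \<Rightarrow> bool" where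
  "gaussian_model M \<pi> X Z \<longleftrightarrow>
     prob_space M \<and>
     X \<in> borel_measurable M \<and> distr M borel X = \<pi> \<and>
     Z \<in> borel_measurable M \<and> distr M borel Z = std_gaussian \<and>
     prob_space.indep_var M borel X borel Z"

definition observation ::
  "('w \<Rightarrow> real ^ 'n) \<Rightarrow> ('w \<Rightarrow> real ^ 'n) \<Rightarrow> real \<Rightarrow> 'w \<Rightarrow> real ^ 'n" where
  "observation X Z s = (\<lambda>\<omega>. s *\<^sub>R X \<omega> + Z \<omega>)"

text \<open>The expectation is taken over the completion of \<open>M\<close>: an arbitrary tie-breaking rule
  need not be Borel measurable, but it only acts on a null set, so the squared error is always
  measurable for the completion.  For a Borel estimator this is the plain expectation over \<open>M\<close>
  (lemma \<open>MSE_borel\<close>).\<close>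

definition MSE ::
  "'w measure \<Rightarrow> ('w \<Rightarrow> real ^ 'n) \<Rightarrow> ('w \<Rightarrow> real ^ 'n) \<Rightarrow> real
     \<Rightarrow> (real ^ 'n \<Rightarrow> real ^ 'n) \<Rightarrow> real" where
  "MSE M X Z s A = (LINT \<omega> | completion M. (norm (X \<omega> - A (observation X Z s \<omega>)))\<^sup>2)"

lemma MSE_borel:
  assumes [measurable]: "X \<in> borel_measurable M" "Z \<in> borel_measurable M"
    and [measurable]: "A \<in> borel_measurable borel"
  shows "MSE M X Z s A = (LINT \<omega> | M. (norm (X \<omega> - A (observation X Z s \<omega>)))\<^sup>2)"
  unfolding MSE_def observation_def by (rule integral_completion) measurable

definition is_MLE ::
  "(real ^ 'n) set \<Rightarrow> real \<Rightarrow> (real ^ 'n \<Rightarrow> real ^ 'n) \<Rightarrow> bool" where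
  "is_MLE T s A \<longleftrightarrow>
     (\<forall>y. is_arg_max (\<lambda>u. y \<bullet> u - s / 2 * (norm u)\<^sup>2) (\<lambda>u. u \<in> T) (A y))"

end

theory Submission
  imports Defs
begin

text \<open>
  The identity already holds for each outcome, before taking expectations.  Fix the signal
  \<open>x \<in> T\<close> and the noise \<open>z\<close>, and complete the square in the log-likelihood at the observation
  \<open>s x + z\<close>: up to a term that does not depend on \<open>u\<close>, the maximum likelihood estimator
  maximises the line \<open>\<langle>z, u\<rangle> - s |x - u|\<^sup>2 / 2\<close> over \<open>u \<in> T\<close>.  The upper envelope \<open>G\<close> of these
  finitely many lines is piecewise linear in \<open>s\<close>, and its slope, wherever it exists, is the slope
  of the line that attains the maximum, that is, minus half of the squared error of the
  estimator.  Since \<open>G 0 = max\<^sub>u \<langle>z, u\<rangle>\<close>, and since for large \<open>s\<close> only the horizontal line \<open>u = x\<close>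
  of height \<open>\<langle>z, x\<rangle>\<close> survives, the fundamental theorem of calculus gives
  \<open>max\<^sub>u \<langle>z, u\<rangle> - \<langle>z, x\<rangle> = 1/2 \<integral>\<^sub>0\<^sup>\<infinity> |x - X\<^sub>s|\<^sup>2 ds\<close>, where \<open>X\<^sub>s\<close> is the estimator at level \<open>s\<close>
  (\<open>nn_integral_half_loss\<close>).

  Taking expectations gives the theorem: \<open>\<langle>Z, X\<rangle>\<close> has mean zero because \<open>X\<close> and \<open>Z\<close> are
  independent and \<open>Z\<close> is centred, and Tonelli's theorem exchanges the integral over \<open>s\<close> with the
  expectation.  An arbitrary family of tie-breaking rules is not jointly measurable in \<open>s\<close> and
  the outcome, so Tonelli's theorem is applied to the measurable slope of the envelope instead.
  For each fixed \<open>s\<close> the two agree almost surely, because a tie places \<open>Z\<close> on one of finitely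
  many hyperplanes (\<open>AE_no_tie\<close>, \<open>MSE_eq_expected_half_loss\<close>).
\<close>

section \<open>Upper envelopes of finitely many lines\<close>

definition upper_envelope :: "'i set \<Rightarrow> ('i \<Rightarrow> real) \<Rightarrow> ('i \<Rightarrow> real) \<Rightarrow> real \<Rightarrow> real" where
  "upper_envelope I a c s = Max ((\<lambda>i. a i - s * c i) ` I)"

text \<open>The rate at which the envelope decreases.  At a tie the steepest of the maximal lines is
  taken; unlike a choice of a maximal index, this is measurable in all parameters.  The value
  \<open>0\<close> for the lines below the envelope does not affect the maximum, because all rates \<open>c i\<close>
  in use are nonnegative.\<close>

definition envelope_rate :: "'i set \<Rightarrow> ('i \<Rightarrow> real) \<Rightarrow> ('i \<Rightarrow> real) \<Rightarrow> real \<Rightarrow> real" where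
  "envelope_rate I a c s =
     Max ((\<lambda>i. if \<forall>j\<in>I. a j - s * c j \<le> a i - s * c i then c i else 0) ` I)"

lemma envelope_rate_eq:
  assumes "finite I" "i \<in> I" "0 \<le> c i"
    and max: "\<And>j. j \<in> I \<Longrightarrow> a j - s * c j \<le> a i - s * c i"
    and tie: "\<And>j. j \<in> I \<Longrightarrow> c j \<noteq> c i \<Longrightarrow> a j - s * c j \<noteq> a i - s * c i"
  shows "envelope_rate I a c s = c i"
proof -
  define f where "f i = (if \<forall>j\<in>I. a j - s * c j \<le> a i - s * c i then c i else 0)" for i
  have fi: "f i = c i" using max by (simp add: f_def)
  have "f j \<le> f i" if j: "j \<in> I" for j
  proof (cases "\<forall>l\<in>I. a l - s * c l \<le> a j - s * c j")
    case True
    with max[OF j] \<open>i \<in> I\<close> have "a j - s * c j = a i - s * c i" by (intro antisym) auto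
    with tie[OF j] have "c j = c i" by blast
    with True show ?thesis by (simp add: fi) (simp add: f_def)
  next
    case False
    then have "f j = 0" unfolding f_def by (rule if_not_P)
    with \<open>0 \<le> c i\<close> show ?thesis by (simp add: fi)
  qed
  with assms(1,2) have "Max (f ` I) = f i" by (intro Max_eqI) auto
  then show ?thesis unfolding envelope_rate_def using fi by (simp add: f_def)
qed

lemma obtain_top_line:
  fixes a c :: "'i \<Rightarrow> real"
  assumes "finite I" "I \<noteq> {}"
  obtains i where "i \<in> I" "\<And>j. j \<in> I \<Longrightarrow> a j - s * c j \<le> a i - s * c i"
proof -
  have "Max ((\<lambda>i. a i - s * c i) ` I) \<in> (\<lambda>i. a i - s * c i) ` I"
    using assms by (intro Max_in) auto
  then obtain i where "i \<in> I" "Max ((\<lambda>i. a i - s * c i) ` I) = a i - s * c i" by auto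
  moreover have "a j - s * c j \<le> Max ((\<lambda>i. a i - s * c i) ` I)" if "j \<in> I" for j
    using that assms by (intro Max_ge) auto
  ultimately show ?thesis using that[of i] by simp
qed

lemma upper_envelope_eq:
  assumes "finite I" "i \<in> I" "\<And>j. j \<in> I \<Longrightarrow> a j - s * c j \<le> a i - s * c i"
  shows "upper_envelope I a c s = a i - s * c i"
  unfolding upper_envelope_def using assms by (intro Max_eqI) auto

lemma envelope_rate_nonneg:
  assumes "finite I" "I \<noteq> {}" and nonneg: "\<And>i. i \<in> I \<Longrightarrow> 0 \<le> c i"
  shows "0 \<le> envelope_rate I a c s"
proof -
  define f where "f = (\<lambda>i. if \<forall>j\<in>I. a j - s * c j \<le> a i - s * c i then c i else 0)"
  have "Max (f ` I) \<in> f ` I" using assms by (intro Max_in) auto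
  moreover have "0 \<le> f i" if "i \<in> I" for i using nonneg[OF that] by (simp add: f_def)
  ultimately have "0 \<le> Max (f ` I)" by force
  then show ?thesis by (simp only: envelope_rate_def f_def)
qed

lemma continuous_on_upper_envelope:
  assumes "finite I" "I \<noteq> {}"
  shows "continuous_on S (upper_envelope I a c)"
  using assms unfolding upper_envelope_def[abs_def]
proof (induction rule: finite_ne_induct)
  case (insert i I)
  have "continuous_on S (\<lambda>s. max (a i - s * c i) (Max ((\<lambda>i. a i - s * c i) ` I)))"
    by (intro continuous_intros insert.IH)
  with insert show ?case by simp
qed (auto intro!: continuous_intros)

definition crossings :: "'i set \<Rightarrow> ('i \<Rightarrow> real) \<Rightarrow> ('i \<Rightarrow> real) \<Rightarrow> real set" where
  "crossings I a c = (\<lambda>(i, j). (a i - a j) / (c i - c j)) ` (I \<times> I)"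

lemma tie_imp_crossing:
  assumes "i \<in> I" "j \<in> I" "c j \<noteq> c i" "a j - s * c j = a i - s * c i"
  shows "s \<in> crossings I a c"
proof -
  have "s = (a i - a j) / (c i - c j)"
    using assms by (simp add: field_simps)
  then show ?thesis unfolding crossings_def using assms by force
qed

text \<open>Away from the crossings all maximal lines coincide.  The other lines stay strictly below them
  in a neighbourhood, where the envelope is therefore a single line.\<close>

lemma upper_envelope_has_derivative:
  assumes "finite I" "I \<noteq> {}" and nonneg: "\<And>i. i \<in> I \<Longrightarrow> 0 \<le> c i"
    and s: "s \<notin> crossings I a c"
  shows "(upper_envelope I a c has_real_derivative - envelope_rate I a c s) (at s)"
proof -
  obtain i where i: "i \<in> I" and max: "\<And>j. j \<in> I \<Longrightarrow> a j - s * c j \<le> a i - s * c i"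
    using obtain_top_line[OF assms(1,2)] by blast
  have tie: "a j - s * c j \<noteq> a i - s * c i" if "j \<in> I" "c j \<noteq> c i" for j
    using tie_imp_crossing[of i I j c a s] i that s by auto
  have "\<forall>\<^sub>F t in nhds s. \<forall>j\<in>I. a j - t * c j \<le> a i - t * c i"
    unfolding eventually_ball_finite_distrib[OF \<open>finite I\<close>]
  proof
    fix j assume j: "j \<in> I"
    show "\<forall>\<^sub>F t in nhds s. a j - t * c j \<le> a i - t * c i"
    proof (cases "c j = c i")
      case True
      then show ?thesis using max[OF j] by simp
    next
      case False
      with tie[OF j] max[OF j] have "0 < (a i - s * c i) - (a j - s * c j)" by simp
      moreover have "((\<lambda>t. (a i - t * c i) - (a j - t * c j)) \<longlongrightarrow>
          (a i - s * c i) - (a j - s * c j)) (nhds s)"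
        by (intro tendsto_intros filterlim_ident)
      ultimately have "\<forall>\<^sub>F t in nhds s. 0 < (a i - t * c i) - (a j - t * c j)"
        by (rule order_tendstoD(1)[rotated])
      then show ?thesis by eventually_elim simp
    qed
  qed
  then have "\<forall>\<^sub>F t in nhds s. upper_envelope I a c t = a i - t * c i"
    by eventually_elim (simp add: upper_envelope_eq[OF \<open>finite I\<close> i])
  moreover have "envelope_rate I a c s = c i"
    using \<open>finite I\<close> i nonneg[OF i] by (rule envelope_rate_eq) (fact max, fact tie)
  moreover have "((\<lambda>t. a i - t * c i) has_real_derivative - c i) (at s)"
    by (auto intro!: derivative_eq_intros)
  ultimately show ?thesis
    using DERIV_cong_ev[OF refl, of "upper_envelope I a c" "\<lambda>t. a i - t * c i" s "- c i" "- c i"]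
    by simp
qed

text \<open>Beyond its crossing with the horizontal line \<open>k\<close>, every descending line lies below that
  line.\<close>

lemma envelope_rate_eventually_zero:
  fixes a c :: "'i \<Rightarrow> real"
  assumes "finite I" "k \<in> I" "c k = 0"
    and nonneg: "\<And>i. i \<in> I \<Longrightarrow> 0 \<le> c i"
    and top: "\<And>i. i \<in> I \<Longrightarrow> c i = 0 \<Longrightarrow> a i \<le> a k"
  obtains b where "0 \<le> b"
    "\<And>s. b \<le> s \<Longrightarrow> envelope_rate I a c s = 0" "upper_envelope I a c b = a k"
proof -
  \<comment> \<open>A descending line \<open>i\<close> reaches the height \<open>a k\<close> at \<open>(a i - a k) / c i\<close>, which the sum
    dominates; adding 1 makes the comparison strict.  Horizontal lines contribute 0, as division
    by 0 yields 0.\<close>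
  define b where "b = (\<Sum>i\<in>I. \<bar>a i - a k\<bar> / c i) + 1"
  have b0: "0 \<le> b" unfolding b_def using nonneg by (intro add_nonneg_nonneg sum_nonneg) auto
  have below: "a i - s * c i < a k" if "i \<in> I" "c i \<noteq> 0" "b \<le> s" for i s
  proof -
    have ci: "0 < c i" using nonneg[of i] that by simp
    have "\<bar>a i - a k\<bar> / c i \<le> (\<Sum>i\<in>I. \<bar>a i - a k\<bar> / c i)"
      using nonneg that \<open>finite I\<close> by (intro member_le_sum) auto
    then have "\<bar>a i - a k\<bar> / c i < s" using that by (simp add: b_def)
    then have "\<bar>a i - a k\<bar> < s * c i" using ci by (simp add: field_simps)
    then show ?thesis by linarith
  qed
  have max: "a i - s * c i \<le> a k - s * c k" if "i \<in> I" "b \<le> s" for i s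
    using below[OF that(1) _ that(2)] top[OF that(1)] \<open>c k = 0\<close>
    by (cases "c i = 0") (simp_all add: less_imp_le)
  show ?thesis
  proof (rule that[OF b0])
    show "envelope_rate I a c s = 0" if "b \<le> s" for s
    proof -
      have "envelope_rate I a c s = c k"
      proof (rule envelope_rate_eq[OF \<open>finite I\<close> \<open>k \<in> I\<close>])
        show "0 \<le> c k" using \<open>c k = 0\<close> by simp
        show "a j - s * c j \<le> a k - s * c k" if "j \<in> I" for j
          using max[OF that \<open>b \<le> s\<close>] .
        show "a j - s * c j \<noteq> a k - s * c k" if "j \<in> I" "c j \<noteq> c k" for j
          using below[of j s] that \<open>b \<le> s\<close> \<open>c k = 0\<close> by simp
      qed
      then show ?thesis using \<open>c k = 0\<close> by simp
    qed
    show "upper_envelope I a c b = a k"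
      using upper_envelope_eq[OF \<open>finite I\<close> \<open>k \<in> I\<close>, of a b c] max[of _ b] \<open>c k = 0\<close> by simp
  qed
qed

text \<open>The envelope falls from \<open>Max (a ` I)\<close> at \<open>0\<close> to its final value \<open>a k\<close>, and it is continuous and
  differentiable off a finite set, so the total fall is the integral of the rate.\<close>

lemma nn_integral_envelope_rate:
  fixes a c :: "'i \<Rightarrow> real"
  assumes "finite I" "k \<in> I" "c k = 0"
    and nonneg: "\<And>i. i \<in> I \<Longrightarrow> 0 \<le> c i"
    and top: "\<And>i. i \<in> I \<Longrightarrow> c i = 0 \<Longrightarrow> a i \<le> a k"
  shows "(\<integral>\<^sup>+ s. ennreal (envelope_rate I a c s) * indicator {0..} s \<partial>lborel) =
         ennreal (Max (a ` I) - a k)"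
proof -
  have ne: "I \<noteq> {}" using assms by auto
  obtain b where b: "0 \<le> b" "\<And>s. b \<le> s \<Longrightarrow> envelope_rate I a c s = 0"
      "upper_envelope I a c b = a k"
    using envelope_rate_eventually_zero[of I k c a, OF assms] by metis
  have "((\<lambda>s. - envelope_rate I a c s) has_integral
      upper_envelope I a c b - upper_envelope I a c 0) {0..b}"
  proof (rule fundamental_theorem_of_calculus_interior_strong)
    show "finite (crossings I a c)" unfolding crossings_def using \<open>finite I\<close> by simp
    show "continuous_on {0..b} (upper_envelope I a c)"
      using assms(1) ne by (rule continuous_on_upper_envelope)
    show "(upper_envelope I a c has_vector_derivative - envelope_rate I a c s) (at s)"
      if "s \<in> {0<..<b} - crossings I a c" for s
      unfolding has_real_derivative_iff_has_vector_derivative[symmetric]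
      by (rule upper_envelope_has_derivative) (use \<open>finite I\<close> ne nonneg that in auto)
  qed fact
  moreover have "upper_envelope I a c 0 = Max (a ` I)" by (simp add: upper_envelope_def)
  ultimately have "(envelope_rate I a c has_integral Max (a ` I) - a k) {0..b}"
    using has_integral_neg[of "\<lambda>s. - envelope_rate I a c s"
        "upper_envelope I a c b - upper_envelope I a c 0" "{0..b}"]
    by (simp add: b(3))
  then have "((\<lambda>s. if s \<in> {0..b} then envelope_rate I a c s else 0) has_integral
      Max (a ` I) - a k) {0..}"
    by (subst has_integral_restrict) auto
  then have "(envelope_rate I a c has_integral Max (a ` I) - a k) {0..}"
    by (rule has_integral_eq[rotated]) (use b in auto)
  then show ?thesis
    by (intro nn_integral_has_integral_lebesgue') (use assms ne in \<open>auto intro: envelope_rate_nonneg\<close>)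
qed

lemma borel_measurable_envelope_rate [measurable (raw)]:
  assumes "finite I"
    and [measurable]: "\<And>i. i \<in> I \<Longrightarrow> a i \<in> borel_measurable N"
      "\<And>i. i \<in> I \<Longrightarrow> c i \<in> borel_measurable N" "s \<in> borel_measurable N"
  shows "(\<lambda>x. envelope_rate I (\<lambda>i. a i x) (\<lambda>i. c i x) (s x)) \<in> borel_measurable N"
  unfolding envelope_rate_def using \<open>finite I\<close>
  by (intro borel_measurable_Max measurable_If pred_intros_finite measurable_const) measurable

section \<open>The standard Gaussian measure\<close>

lemma sets_std_gaussian [measurable_cong]: "sets std_gaussian = sets borel"
  by (simp add: std_gaussian_def)

lemma AE_std_gaussian_not_hyperplane:
  fixes v :: "real ^ 'n"
  assumes "v \<noteq> 0"
  shows "AE z in std_gaussian. v \<bullet> z \<noteq> r"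
proof -
  have "{z. v \<bullet> z = r} \<in> null_sets (completion lborel)"
    using negligible_hyperplane[of v r] assms by (simp add: negligible_iff_null_sets)
  then have "{z. v \<bullet> z = r} \<in> null_sets lborel"
    by (subst (asm) null_sets_completion_iff) (simp_all add: closed_hyperplane borel_closed)
  then have "AE z in lborel. v \<bullet> z \<noteq> r"
    using AE_not_in by fastforce
  then show ?thesis
    unfolding std_gaussian_def by (subst AE_density) auto
qed

lemma prod_Basis_vec:
  "(\<Prod>b\<in>(Basis :: (real^'n) set). g b) = (\<Prod>i\<in>UNIV. g (axis i 1))"
proof -
  have "(Basis :: (real^'n) set) = (\<lambda>i. axis i 1) ` UNIV" by (auto simp: Basis_vec_def)
  moreover have "inj (\<lambda>i::'n. axis i (1::real))" by (auto simp: inj_on_def axis_eq_axis)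
  ultimately show ?thesis using prod.reindex[of "\<lambda>i::'n. axis i (1::real)" UNIV g]
    by (simp only: o_def)
qed

text \<open>The integrand \<open>|z\<^sub>i|\<close> is absorbed into the \<open>i\<close>-th factor of the density, which keeps the product
  form and reduces the claim to the first absolute moment of the one-dimensional normal
  distribution.\<close>

lemma integrable_std_gaussian_component:
  "integrable (std_gaussian :: (real^'n) measure) (\<lambda>z. z $ i)"
proof (rule integrableI_bounded)
  let ?f = "\<lambda>(b::real^'n) x. std_normal_density x * (if b = axis i 1 then \<bar>x\<bar> else 1)"
  have "(\<integral>\<^sup>+ z. ennreal (norm (z $ i)) \<partial>(std_gaussian :: (real^'n) measure))
      = (\<integral>\<^sup>+ z. ennreal ((\<Prod>i\<in>UNIV. std_normal_density (z $ i)) * \<bar>z $ i\<bar>) \<partial>(lborel :: (real^'n) measure))"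
    unfolding std_gaussian_def
    by (subst nn_integral_density) (auto simp: ennreal_mult' prod_nonneg)
  also have "\<dots> = (\<integral>\<^sup>+ z. (\<Prod>b\<in>(Basis::(real^'n) set). ennreal (?f b (z \<bullet> b))) \<partial>lborel)"
    by (intro nn_integral_cong, subst prod_ennreal)
       (auto simp: prod_Basis_vec prod.distrib axis_eq_axis inner_axis)
  also have "\<dots> = (\<Prod>b\<in>(Basis::(real^'n) set). \<integral>\<^sup>+ x. ennreal (?f b x) \<partial>lborel)"
    by (rule nn_integral_lborel_prod) auto
  also have "\<dots> < \<infinity>"
  proof -
    have "(\<integral>\<^sup>+ x. ennreal (?f b x) \<partial>lborel) < \<infinity>" for b
      using integrable_std_normal_moment_abs[of 1] integrable_std_normal_moment_abs[of 0]
      by (cases "b = axis i 1") (auto simp: integrable_iff_bounded abs_mult)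
    then have "(\<integral>\<^sup>+ x. ennreal (?f b x) \<partial>lborel) \<noteq> \<top>" for b by (simp add: less_top)
    then have "(\<Prod>b\<in>(Basis::(real^'n) set). \<integral>\<^sup>+ x. ennreal (?f b x) \<partial>lborel) \<noteq> \<top>"
      unfolding ennreal_prod_eq_top by blast
    then show ?thesis by (simp only: less_top infinity_ennreal_def)
  qed
  finally show "(\<integral>\<^sup>+ z. ennreal (norm (z $ i)) \<partial>(std_gaussian :: (real^'n) measure)) < \<infinity>" .
qed simp

text \<open>The density is even and Lebesgue measure is invariant under reflection, so the mean equals its
  own negative.\<close>

lemma integral_std_gaussian_component:
  "(LINT z | (std_gaussian :: (real^'n) measure). z $ i) = 0"
proof -
  let ?p = "\<lambda>z::real^'n. \<Prod>i\<in>UNIV. std_normal_density (z $ i)"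
  have symm: "(lborel :: (real^'n) measure) = distr lborel borel uminus"
    using lborel_affine[of "-1" "0 :: real^'n"] by (simp add: density_1)
  have "(LINT z | std_gaussian. z $ i) = (LINT z | lborel. ?p z * z $ i)"
    unfolding std_gaussian_def
    by (subst integral_density) (auto intro!: prod_nonneg)
  also have "\<dots> = (LINT z | lborel. ?p (- z) * (- z) $ i)"
    by (subst symm, subst integral_distr) auto
  also have "\<dots> = - (LINT z | lborel. ?p z * z $ i)"
    by (simp add: std_normal_density_def)
  also have "(LINT z | lborel. ?p z * z $ i) = (LINT z | std_gaussian. z $ i)"
    unfolding std_gaussian_def
    by (subst integral_density) (auto intro!: prod_nonneg)
  finally show ?thesis by simp
qed

section \<open>The likelihood as an envelope of lines\<close>

lemma is_MLE_mem: "is_MLE T s A \<Longrightarrow> A y \<in> T"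
  by (simp add: is_MLE_def is_arg_max_def)

text \<open>Completing the square: the two objectives differ by \<open>s |x|\<^sup>2 / 2\<close>, which does not depend on the
  candidate.\<close>

lemma is_MLE_top_line:
  assumes "is_MLE T s A" "u \<in> T"
  shows "z \<bullet> u - s * ((norm (x - u))\<^sup>2 / 2)
    \<le> z \<bullet> A (s *\<^sub>R x + z) - s * ((norm (x - A (s *\<^sub>R x + z)))\<^sup>2 / 2)"
proof -
  let ?v = "A (s *\<^sub>R x + z)"
  have "(s *\<^sub>R x + z) \<bullet> u - s / 2 * (norm u)\<^sup>2 \<le> (s *\<^sub>R x + z) \<bullet> ?v - s / 2 * (norm ?v)\<^sup>2"
    using assms unfolding is_MLE_def is_arg_max_def by (meson not_less)
  moreover have "z \<bullet> w - s * ((norm (x - w))\<^sup>2 / 2)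
      = (s *\<^sub>R x + z) \<bullet> w - s / 2 * (norm w)\<^sup>2 - s / 2 * (norm x)\<^sup>2" for w
    by (simp add: power2_norm_eq_inner inner_diff_left inner_diff_right inner_add_left
        inner_commute algebra_simps add_divide_distrib diff_divide_distrib)
  ultimately show ?thesis by simp
qed

text \<open>Half of the squared error of the maximum likelihood estimator when the signal is \<open>x\<close> and the
  noise is \<open>z\<close>; at a tie, the largest error of a maximiser.\<close>

abbreviation half_loss :: "(real ^ 'n) set \<Rightarrow> real ^ 'n \<Rightarrow> real ^ 'n \<Rightarrow> real \<Rightarrow> real" where
  "half_loss T x z \<equiv> envelope_rate T (\<lambda>u. z \<bullet> u) (\<lambda>u. (norm (x - u))\<^sup>2 / 2)"

lemma squared_error_eq_half_loss:
  assumes "finite T" "is_MLE T s A"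
    and tie: "\<And>u v. u \<in> T \<Longrightarrow> v \<in> T \<Longrightarrow> u \<noteq> v \<Longrightarrow>
      (u - v) \<bullet> z \<noteq> s * ((norm (x - u))\<^sup>2 / 2) - s * ((norm (x - v))\<^sup>2 / 2)"
  shows "(norm (x - A (s *\<^sub>R x + z)))\<^sup>2 = 2 * half_loss T x z s"
proof -
  let ?v = "A (s *\<^sub>R x + z)"
  have v: "?v \<in> T" using assms(2) by (rule is_MLE_mem)
  have "half_loss T x z s = (norm (x - ?v))\<^sup>2 / 2"
  proof (rule envelope_rate_eq[OF \<open>finite T\<close> v])
    show "z \<bullet> u - s * ((norm (x - u))\<^sup>2 / 2) \<le> z \<bullet> ?v - s * ((norm (x - ?v))\<^sup>2 / 2)"
      if "u \<in> T" for u
      using assms(2) that by (rule is_MLE_top_line)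
    show "z \<bullet> u - s * ((norm (x - u))\<^sup>2 / 2) \<noteq> z \<bullet> ?v - s * ((norm (x - ?v))\<^sup>2 / 2)"
      if "u \<in> T" "(norm (x - u))\<^sup>2 / 2 \<noteq> (norm (x - ?v))\<^sup>2 / 2" for u
    proof -
      have "(u - ?v) \<bullet> z \<noteq> s * ((norm (x - u))\<^sup>2 / 2) - s * ((norm (x - ?v))\<^sup>2 / 2)"
        using tie[OF that(1) v] that(2) by blast
      then show ?thesis
        unfolding inner_diff_left inner_commute[of z] by linarith
    qed
  qed simp
  then show ?thesis by simp
qed

text \<open>The pathwise form of the theorem.  The line \<open>u = x\<close> is the only horizontal one.\<close>

lemma nn_integral_half_loss:
  assumes "finite T" "x \<in> T"
  shows "(\<integral>\<^sup>+ s. ennreal (half_loss T x z s) * indicator {0..} s \<partial>lborel)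
    = ennreal (Max ((\<lambda>u. z \<bullet> u) ` T) - z \<bullet> x)"
  by (rule nn_integral_envelope_rate[OF assms]) simp_all

lemma prior_on_AE_mem:
  assumes "finite T" "prior_on T \<pi>" "X \<in> borel_measurable M" "distr M borel X = \<pi>"
  shows "AE \<omega> in M. X \<omega> \<in> T"
proof -
  interpret \<pi>: prob_space \<pi> using assms(2) by (simp add: prior_on_def)
  have T: "T \<in> sets \<pi>"
    using assms(2) borel_closed[OF finite_imp_closed[OF assms(1)]] by (simp add: prior_on_def)
  have "\<pi>.prob T = 1" using assms(2) by (simp add: prior_on_def measure_def)
  with T have "AE x in distr M borel X. x \<in> T"
    unfolding assms(4) by (simp only: \<pi>.AE_in_set_eq_1)
  then show ?thesis by (rule AE_distrD[OF assms(3), where P = "\<lambda>x. x \<in> T"])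
qed

section \<open>Expectations in the Gaussian additive model\<close>

context
  fixes T :: "(real ^ 'n) set" and \<pi> :: "(real ^ 'n) measure"
    and M :: "'w measure" and X Z :: "'w \<Rightarrow> real ^ 'n"
  assumes T: "finite T" "T \<noteq> {}" and prior: "prior_on T \<pi>" and model: "gaussian_model M \<pi> X Z"
begin

interpretation prob_space M
  using model by (simp add: gaussian_model_def)

lemma signal_measurable [measurable]: "X \<in> borel_measurable M"
  and noise_measurable [measurable]: "Z \<in> borel_measurable M"
  and noise_distr: "distr M borel Z = std_gaussian"
  and indep_signal_noise: "indep_var borel X borel Z"
  using model by (auto simp: gaussian_model_def)

lemma signal_AE_mem: "AE \<omega> in M. X \<omega> \<in> T"
  using prior_on_AE_mem[OF T(1) prior signal_measurable] model by (simp add: gaussian_model_def)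

lemma noise_component:
  shows integrable_noise_component: "integrable M (\<lambda>\<omega>. Z \<omega> $ i)"
    and expectation_noise_component: "expectation (\<lambda>\<omega>. Z \<omega> $ i) = 0"
proof -
  show "integrable M (\<lambda>\<omega>. Z \<omega> $ i)"
    using integrable_std_gaussian_component[of i]
    by (subst (asm) noise_distr[symmetric], subst (asm) integrable_distr_eq) auto
  show "expectation (\<lambda>\<omega>. Z \<omega> $ i) = 0"
    using integral_std_gaussian_component[of i]
    by (subst (asm) noise_distr[symmetric], subst (asm) integral_distr) auto
qed

text \<open>The signal is bounded because \<open>T\<close> is finite, so the expectations of the coordinate products
  factorise by independence.\<close>

lemma signal_noise_uncorrelated:
  shows integrable_noise_inner_signal: "integrable M (\<lambda>\<omega>. Z \<omega> \<bullet> X \<omega>)"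
    and expectation_noise_inner_signal: "expectation (\<lambda>\<omega>. Z \<omega> \<bullet> X \<omega>) = 0"
proof -
  have indep: "indep_var borel (\<lambda>\<omega>. X \<omega> $ i) borel (\<lambda>\<omega>. Z \<omega> $ i)" for i
    using indep_var_compose[OF indep_signal_noise, of "\<lambda>x. x $ i" borel "\<lambda>x. x $ i" borel]
    by (simp add: comp_def)
  have X: "integrable M (\<lambda>\<omega>. X \<omega> $ i)" for i
  proof (rule integrable_const_bound[where B = "\<Sum>t\<in>T. \<bar>t $ i\<bar>"])
    show "AE \<omega> in M. norm (X \<omega> $ i) \<le> (\<Sum>t\<in>T. \<bar>t $ i\<bar>)"
      using signal_AE_mem
    proof eventually_elim
      case (elim \<omega>)
      then show ?case using member_le_sum[OF elim, of "\<lambda>t. \<bar>t $ i\<bar>"] T(1) by simp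
    qed
  qed (rule measurable_compose[OF signal_measurable], measurable)
  have int: "integrable M (\<lambda>\<omega>. X \<omega> $ i * Z \<omega> $ i)" for i
    by (rule indep_var_integrable[OF indep X integrable_noise_component])
  have zero: "expectation (\<lambda>\<omega>. X \<omega> $ i * Z \<omega> $ i) = 0" for i
    by (simp add: indep_var_lebesgue_integral[OF indep X integrable_noise_component]
        expectation_noise_component)
  have eq: "Z \<omega> \<bullet> X \<omega> = (\<Sum>i\<in>UNIV. X \<omega> $ i * Z \<omega> $ i)" for \<omega>
    by (simp add: inner_vec_def mult.commute)
  show "integrable M (\<lambda>\<omega>. Z \<omega> \<bullet> X \<omega>)" unfolding eq using int by simp
  show "expectation (\<lambda>\<omega>. Z \<omega> \<bullet> X \<omega>) = 0" unfolding eq using int zero by simp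
qed

lemma noise_max:
  shows integrable_noise_max: "integrable M (\<lambda>\<omega>. Max ((\<lambda>t. Z \<omega> \<bullet> t) ` T))"
    and expectation_noise_max: "expectation (\<lambda>\<omega>. Max ((\<lambda>t. Z \<omega> \<bullet> t) ` T)) = gaussian_width T"
proof -
  have meas: "(\<lambda>z. Max ((\<lambda>t. z \<bullet> t) ` T)) \<in> borel_measurable borel"
    using T(1) by (intro borel_measurable_Max) measurable
  have inner: "integrable M (\<lambda>\<omega>. Z \<omega> \<bullet> t)" for t
    unfolding inner_vec_def using integrable_noise_component by simp
  show "integrable M (\<lambda>\<omega>. Max ((\<lambda>t. Z \<omega> \<bullet> t) ` T))"
  proof (rule Bochner_Integration.integrable_bound)
    show "integrable M (\<lambda>\<omega>. \<Sum>t\<in>T. \<bar>Z \<omega> \<bullet> t\<bar>)" using inner by simp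
    show "(\<lambda>\<omega>. Max ((\<lambda>t. Z \<omega> \<bullet> t) ` T)) \<in> borel_measurable M"
      using measurable_compose[OF noise_measurable meas] .
    show "AE \<omega> in M. norm (Max ((\<lambda>t. Z \<omega> \<bullet> t) ` T)) \<le> norm (\<Sum>t\<in>T. \<bar>Z \<omega> \<bullet> t\<bar>)"
    proof (rule AE_I2)
      fix \<omega>
      have "Max ((\<lambda>t. Z \<omega> \<bullet> t) ` T) \<in> (\<lambda>t. Z \<omega> \<bullet> t) ` T" using T by (intro Max_in) auto
      then obtain t where "t \<in> T" "Max ((\<lambda>t. Z \<omega> \<bullet> t) ` T) = Z \<omega> \<bullet> t" by auto
      then show "norm (Max ((\<lambda>t. Z \<omega> \<bullet> t) ` T)) \<le> norm (\<Sum>t\<in>T. \<bar>Z \<omega> \<bullet> t\<bar>)"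
        using member_le_sum[of t T "\<lambda>t. \<bar>Z \<omega> \<bullet> t\<bar>"] T(1) by simp
    qed
  qed
  show "expectation (\<lambda>\<omega>. Max ((\<lambda>t. Z \<omega> \<bullet> t) ` T)) = gaussian_width T"
    unfolding gaussian_width_def noise_distr[symmetric] using meas
    by (subst integral_distr) auto
qed

text \<open>For each of the finitely many values of the signal and each pair of distinct candidates, a tie confines
  the noise to a hyperplane, which is a null set for an absolutely continuous law.\<close>

lemma AE_no_tie:
  "AE \<omega> in M. \<forall>u\<in>T. \<forall>v\<in>T. u \<noteq> v \<longrightarrow>
     (u - v) \<bullet> Z \<omega> \<noteq> s * ((norm (X \<omega> - u))\<^sup>2 / 2) - s * ((norm (X \<omega> - v))\<^sup>2 / 2)"
proof -
  have "AE \<omega> in M. (u - v) \<bullet> Z \<omega> \<noteq> r" if "u \<noteq> v" for u v r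
    using AE_std_gaussian_not_hyperplane[of "u - v" r] that
    unfolding noise_distr[symmetric] by (intro AE_distrD[OF noise_measurable]) simp
  then have "AE \<omega> in M. \<forall>x\<in>T. \<forall>u\<in>T. \<forall>v\<in>T. u \<noteq> v \<longrightarrow>
      (u - v) \<bullet> Z \<omega> \<noteq> s * ((norm (x - u))\<^sup>2 / 2) - s * ((norm (x - v))\<^sup>2 / 2)"
    using T(1) by (intro AE_finite_allI) auto
  with signal_AE_mem show ?thesis by eventually_elim blast
qed

lemma half_loss_measurable:
  "(\<lambda>p. half_loss T (X (snd p)) (Z (snd p)) (fst p)) \<in> borel_measurable (lborel \<Otimes>\<^sub>M M)"
  using T(1) by (intro borel_measurable_envelope_rate) measurable

lemma half_loss_nonneg: "0 \<le> half_loss T x z s"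
  using T by (intro envelope_rate_nonneg) auto

lemma half_loss_section_measurable [measurable]:
  "(\<lambda>\<omega>. half_loss T (X \<omega>) (Z \<omega>) s) \<in> borel_measurable M"
  using T(1) by (intro borel_measurable_envelope_rate) measurable

text \<open>The estimator may break ties in a nonmeasurable way.  Its squared error agrees with a
  measurable function outside a null set, so it is measurable for the completion and has the
  same integral.\<close>

lemma MSE_eq_expected_half_loss:
  assumes "is_MLE T s A"
  shows "MSE M X Z s A = 2 * expectation (\<lambda>\<omega>. half_loss T (X \<omega>) (Z \<omega>) s)"
proof -
  let ?err = "\<lambda>\<omega>. (norm (X \<omega> - A (observation X Z s \<omega>)))\<^sup>2"
  let ?h = "\<lambda>\<omega>. 2 * half_loss T (X \<omega>) (Z \<omega>) s"
  have h: "?h \<in> borel_measurable M" by measurable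
  have ae: "AE \<omega> in completion M. ?h \<omega> = ?err \<omega>"
    using AE_completion[OF AE_no_tie[of s]]
  proof eventually_elim
    case (elim \<omega>)
    then show ?case
      unfolding observation_def
      by (subst squared_error_eq_half_loss[OF T(1) assms]) auto
  qed
  have err: "?err \<in> borel_measurable (completion M)"
  proof (rule measurableI)
    fix B :: "real set" assume B: "B \<in> sets borel"
    show "?err -` B \<inter> space (completion M) \<in> sets (completion M)"
    proof (rule completion.in_sets_AE)
      show "?h -` B \<inter> space (completion M) \<in> sets (completion M)"
        using measurable_sets[OF measurable_completion[OF h] B] .
      show "AE \<omega> in completion M. \<omega> \<in> ?h -` B \<inter> space (completion M) \<longleftrightarrow>
          \<omega> \<in> ?err -` B \<inter> space (completion M)"
        using ae by eventually_elim (simp only: vimage_eq Int_iff)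
    qed simp
  qed simp
  have "MSE M X Z s A = integral\<^sup>L (completion M) ?h"
    unfolding MSE_def
    by (rule integral_cong_AE[OF err measurable_completion[OF h]]) (use ae in \<open>auto simp: eq_commute\<close>)
  also have "\<dots> = 2 * expectation (\<lambda>\<omega>. half_loss T (X \<omega>) (Z \<omega>) s)"
    using integral_completion[OF h] by simp
  finally show ?thesis .
qed

text \<open>By Tonelli's theorem the integral over \<open>s\<close> may be evaluated first, for each outcome separately.
  It gives the maximum minus \<open>\<langle>Z, X\<rangle>\<close>, and the second term vanishes in expectation.\<close>

lemma has_bochner_integral_half_loss:
  "has_bochner_integral (lborel \<Otimes>\<^sub>M M)
     (\<lambda>p. indicator {0..} (fst p) * half_loss T (X (snd p)) (Z (snd p)) (fst p)) (gaussian_width T)"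
    (is "has_bochner_integral _ ?f _")
proof -
  interpret pair_sigma_finite lborel M ..
  let ?D = "\<lambda>\<omega>. Max ((\<lambda>t. Z \<omega> \<bullet> t) ` T) - Z \<omega> \<bullet> X \<omega>"
  have int: "integrable M ?D"
    using integrable_noise_max integrable_noise_inner_signal by simp
  have exp: "expectation ?D = gaussian_width T"
    using integrable_noise_max integrable_noise_inner_signal
    by (simp add: expectation_noise_max expectation_noise_inner_signal)
  have nonneg: "AE \<omega> in M. 0 \<le> ?D \<omega>"
    using signal_AE_mem
  proof eventually_elim
    case (elim \<omega>)
    then have "Z \<omega> \<bullet> X \<omega> \<le> Max ((\<lambda>t. Z \<omega> \<bullet> t) ` T)" using T(1) by (intro Max_ge) auto
    then show ?case by simp
  qed
  have meas: "?f \<in> borel_measurable (lborel \<Otimes>\<^sub>M M)"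
    using half_loss_measurable by measurable
  have "integral\<^sup>N (lborel \<Otimes>\<^sub>M M) (\<lambda>p. ennreal (?f p))
      = (\<integral>\<^sup>+ \<omega>. (\<integral>\<^sup>+ s. ennreal (?f (s, \<omega>)) \<partial>lborel) \<partial>M)"
    using meas by (subst nn_integral_snd[symmetric]) auto
  also have "\<dots> = (\<integral>\<^sup>+ \<omega>. ennreal (?D \<omega>) \<partial>M)"
  proof (rule nn_integral_cong_AE)
    show "AE \<omega> in M. (\<integral>\<^sup>+ s. ennreal (?f (s, \<omega>)) \<partial>lborel) = ennreal (?D \<omega>)"
      using signal_AE_mem
    proof eventually_elim
      case (elim \<omega>)
      have "(\<integral>\<^sup>+ s. ennreal (?f (s, \<omega>)) \<partial>lborel)
          = (\<integral>\<^sup>+ s. ennreal (half_loss T (X \<omega>) (Z \<omega>) s) * indicator {0..} s \<partial>lborel)"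
        by (intro nn_integral_cong) (auto simp: indicator_def)
      then show ?case using nn_integral_half_loss[OF T(1) elim] by simp
    qed
  qed
  also have "\<dots> = ennreal (gaussian_width T)"
    using nn_integral_eq_integral[OF int nonneg] exp by simp
  finally have "integral\<^sup>N (lborel \<Otimes>\<^sub>M M) (\<lambda>p. ennreal (?f p)) = ennreal (gaussian_width T)" .
  moreover have "0 \<le> gaussian_width T"
    using integral_nonneg_AE[OF nonneg] exp by simp
  ultimately show ?thesis
    using meas half_loss_nonneg by (intro has_bochner_integral_nn_integral) auto
qed

lemma has_bochner_integral_expected_half_loss:
  "has_bochner_integral lborel
     (\<lambda>s. indicator {0..} s * expectation (\<lambda>\<omega>. half_loss T (X \<omega>) (Z \<omega>) s)) (gaussian_width T)"
proof -
  interpret pair_sigma_finite lborel M ..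
  note f = has_bochner_integral_half_loss
  show ?thesis
    using integrable_fst'[OF integrable.intros[OF f]] integral_fst'[OF integrable.intros[OF f]]
      has_bochner_integral_integral_eq[OF f]
    by (simp add: has_bochner_integral_iff)
qed

end

theorem proposition2p3:
  fixes T :: "(real ^ 'n) set"
    and \<pi> :: "(real ^ 'n) measure"
    and M :: "'w measure"
    and X Z :: "'w \<Rightarrow> real ^ 'n"
    and XMLE :: "real \<Rightarrow> real ^ 'n \<Rightarrow> real ^ 'n"
  assumes "finite T" and "T \<noteq> {}"
    and "prior_on T \<pi>"
    and "gaussian_model M \<pi> X Z"
    and "\<And>s. s \<ge> 0 \<Longrightarrow> is_MLE T s (XMLE s)"
  shows "set_integrable lborel {0..} (\<lambda>s. MSE M X Z s (XMLE s)) \<and>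
         gaussian_width T = 1 / 2 * (LINT s:{0..}|lborel. MSE M X Z s (XMLE s))"
proof -
  note f = has_bochner_integral_expected_half_loss[OF assms(1-4)]
  have "indicator {0..} s *\<^sub>R MSE M X Z s (XMLE s)
      = 2 * (indicator {0..} s * (LINT \<omega>|M. half_loss T (X \<omega>) (Z \<omega>) s))" for s
    using MSE_eq_expected_half_loss[OF assms(1-4) assms(5)[of s]]
    by (cases "0 \<le> s") auto
  then show ?thesis
    using f by (simp only: set_integrable_def set_lebesgue_integral_def)
      (simp add: has_bochner_integral_iff)
qed

end
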